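(* A sequent $S$ of Łukasiewicz formulas is derivable in $\mathbf{GŁ_s}$ if and only if $\models^*_{Ł} S$.
   Context: Łukasiewicz formulas are built from propositional variables and $\bot$ using $\Rightarrow$; a valuation $v$ maps them into $[-1,0]$ with $v(\bot)=-1$ and $v(A\Rightarrow B)=\min(0,v(B)-v(A))$. A sequent $\Gamma\vdash\Delta$ is a pair of finite multisets of formulas; $\models^*_Ł\Gamma\vdash\Delta$ means $\sum_{A\in\Gamma}v(A)\le\sum_{B\in\Delta}v(B)$ (ordinary real sums, empty sum $0$) for every valuation $v$. In particular $\models^*_Ł\vdash\varphi$ is Łukasiewicz validity of $\varphi$. Calculus $\mathbf{GŁ_s}$ (premise(s) / conclusion; commas are multiset union): axioms $A\vdash A$, $\vdash$, and $\bot\vdash A$; (W) $\Gamma\vdash\Delta/\Gamma,A\vdash\Delta$; (M) premises $\Gamma_1\vdash\Delta_1$ and $\Gamma_2\vdash\Delta_2$, conclusion $\Gamma_1,\Gamma_2\vdash\Delta_1,\Delta_2$; (C) from $\Gamma,\ldots,\Gamma\vdash\Delta,\ldots,\Delta$ ($n$ copies of each, $n>0$) infer $\Gamma\vdash\Delta$; $(\Rightarrow,l)$ $\Gamma,B,B\Rightarrow A\vdash\Delta,A/\Gamma,A\Rightarrow B\vdash\Delta$; $(\Rightarrow,r)$ premises $\Gamma\vdash\Delta$ and $\Gamma,A\vdash\Delta,B$, conclusion $\Gamma\vdash\Delta,A\Rightarrow B$. *)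

theory Defs
  imports Complex_Main "HOL-Library.Multiset"
begin

datatype 'a form =
    Var 'a
  | Bot  ("\<^bold>\<bottom>")
  | Imp "'a form" "'a form"  (infixr "\<^bold>\<Rightarrow>" 65)

type_synonym 'a sequent = "'a form multiset \<times> 'a form multiset"

definition valuation :: "('a form \<Rightarrow> real) \<Rightarrow> bool" where
  "valuation v \<longleftrightarrow>
     (\<forall>A. v A \<in> {-1..0}) \<and>
     v \<^bold>\<bottom> = -1 \<and>
     (\<forall>A B. v (A \<^bold>\<Rightarrow> B) = min 0 (v B - v A))"

definition luk_valid :: "'a sequent \<Rightarrow> bool" where
  "luk_valid S \<longleftrightarrow>
     (\<forall>v. valuation v \<longrightarrow> (\<Sum>A\<in>#fst S. v A) \<le> (\<Sum>B\<in>#snd S. v B))"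

inductive GLs :: "'a sequent \<Rightarrow> bool" where
  ax_id: "GLs ({#A#}, {#A#})"
| ax_empty: "GLs ({#}, {#})"
| ax_bot: "GLs ({#\<^bold>\<bottom>#}, {#A#})"
| W: "GLs (\<Gamma>, \<Delta>) \<Longrightarrow> GLs (\<Gamma> + {#A#}, \<Delta>)"
| M: "GLs (\<Gamma>1, \<Delta>1) \<Longrightarrow> GLs (\<Gamma>2, \<Delta>2) \<Longrightarrow> GLs (\<Gamma>1 + \<Gamma>2, \<Delta>1 + \<Delta>2)"
| C: "n > 0 \<Longrightarrow> GLs (repeat_mset n \<Gamma>, repeat_mset n \<Delta>) \<Longrightarrow> GLs (\<Gamma>, \<Delta>)"
| Imp_l: "GLs (\<Gamma> + {#B, B \<^bold>\<Rightarrow> A#}, \<Delta> + {#A#}) \<Longrightarrow> GLs (\<Gamma> + {#A \<^bold>\<Rightarrow> B#}, \<Delta>)"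
| Imp_r: "GLs (\<Gamma>, \<Delta>) \<Longrightarrow> GLs (\<Gamma> + {#A#}, \<Delta> + {#B#}) \<Longrightarrow> GLs (\<Gamma>, \<Delta> + {#A \<^bold>\<Rightarrow> B#})"

end

(*
  Completeness. Once the right side is atomic, let formulas be independent variables constrained only
  by linear inequalities: \<bottom> \<le> A \<le> 0 and A \<Rightarrow> B \<le> B - A. A sequent valid in this relaxation is derivable,
  as Farkas' lemma yields an integer certificate, from which the contraction rule (C), the axioms and
  the left rule build a derivation. What the relaxation forgets is A \<Rightarrow> B \<ge> min 0 (B - A). This is recovered
  by a reversible detour: in the presence of a left formula, any number of copies of its proper
  subformulas can be added to both sides, and decomposing the right copies of A \<Rightarrow> B by (\<Rightarrow>,r) leaves
  behind arbitrarily large penalties for violating one of A \<Rightarrow> B \<ge> 0, A \<Rightarrow> B \<ge> B - A.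
*)

theory Submission
  imports Defs
begin

subsection \<open>Farkas' lemma\<close>

definition lin :: "(('b \<Rightarrow> 'f::linordered_field) \<Rightarrow> 'f) \<Rightarrow> bool" where
  "lin f \<longleftrightarrow> (\<forall>x y r. f (\<lambda>b. x b + r * y b) = f x + r * f y)"

lemma lin_step: "lin f \<Longrightarrow> f (\<lambda>b. x b + r * y b) = f x + r * f y"
  by (simp add: lin_def)

lemma lin_scale:
  assumes "lin f"
  shows "f (\<lambda>b. r * y b) = r * f y"
proof -
  have "f (\<lambda>b. 0) = 0"
    using lin_step[OF assms, of "\<lambda>b. 0" 1 "\<lambda>b. 0"] by simp
  then show ?thesis
    using lin_step[OF assms, of "\<lambda>b. 0" r y] by simp
qed

text \<open>Bartl's proof, by induction on the number of functionals: a point \<open>z\<close> violating the implication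
  without \<open>a i\<close> serves to project onto the kernel of \<open>a i\<close>.\<close>

theorem farkas:
  fixes a :: "'i \<Rightarrow> ('b \<Rightarrow> 'f::linordered_field) \<Rightarrow> 'f"
  assumes "finite I" and "\<And>i. i \<in> I \<Longrightarrow> lin (a i)" and "lin c"
    and "\<And>x. (\<And>i. i \<in> I \<Longrightarrow> a i x \<le> 0) \<Longrightarrow> c x \<le> 0"
  shows "\<exists>u. (\<forall>i\<in>I. 0 \<le> u i) \<and> (\<forall>x. c x = (\<Sum>i\<in>I. u i * a i x))"
  using assms
proof (induction I arbitrary: a c rule: finite_induct)
  case empty
  \<comment> \<open>Without constraints the hypothesis applies to both \<open>x\<close> and its
    negative, so \<open>c\<close> vanishes.\<close>
  have "c x = 0" for x
    using empty(3)[of x] empty(3)[of "\<lambda>b. (-1) * x b"] lin_scale[OF empty(2), of "-1" x] by simp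
  then show ?case by simp
next
  case (insert i I)
  show ?case
  proof (cases "\<forall>x. (\<forall>j\<in>I. a j x \<le> 0) \<longrightarrow> c x \<le> 0")
    case True
    then obtain u where u: "\<forall>j\<in>I. 0 \<le> u j" "\<forall>x. c x = (\<Sum>j\<in>I. u j * a j x)"
      using insert.IH[of a c] insert.prems by auto
    have "(\<Sum>j\<in>I. (u(i := 0)) j * a j x) = (\<Sum>j\<in>I. u j * a j x)" for x
      using insert.hyps by (intro sum.cong) auto
    then show ?thesis
      using u insert.hyps by (intro exI[of _ "u(i := 0)"]) auto
  next
    case False
    then obtain z0 where z0: "\<forall>j\<in>I. a j z0 \<le> 0" "c z0 > 0"
      by (auto simp: not_le)
    then have pos: "a i z0 > 0"
      using insert.prems(3)[of z0] by (force simp: not_le)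
    define z where "z = (\<lambda>b. inverse (a i z0) * z0 b)"
    have z_scale: "f z = inverse (a i z0) * f z0" if "lin f" for f
      unfolding z_def using lin_scale[OF that] .
    have zi: "a i z = 1" and zc: "c z > 0" and zj: "\<And>j. j \<in> I \<Longrightarrow> a j z \<le> 0"
      using pos z0 insert.prems by (auto simp: z_scale mult_le_0_iff)
    define proj where "proj x = (\<lambda>b. x b + (- a i x) * z b)" for x
    have proj_eq: "f (proj x) = f x - a i x * f z" if "lin f" for f x
      unfolding proj_def using lin_step[OF that, of x "- a i x" z] by simp
    have lin_proj: "lin (\<lambda>x. f x - f z * a i x)" if "lin f" for f
      unfolding lin_def
      by (simp add: lin_step[OF that] lin_step[OF insert.prems(1)[OF insertI1]] algebra_simps)
    have "c x - c z * a i x \<le> 0" if "\<And>j. j \<in> I \<Longrightarrow> a j x - a j z * a i x \<le> 0" for x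
    proof -
      have "a j (proj x) \<le> 0" if "j \<in> insert i I" for j
        using that \<open>\<And>j. j \<in> I \<Longrightarrow> a j x - a j z * a i x \<le> 0\<close>[of j] insert.prems(1)[of j] zi
        by (auto simp: proj_eq mult.commute)
      then have "c (proj x) \<le> 0" using insert.prems(3) by blast
      then show ?thesis using insert.prems(2) by (simp add: proj_eq mult.commute)
    qed
    then obtain u where u: "\<forall>j\<in>I. 0 \<le> u j"
      "\<forall>x. c x - c z * a i x = (\<Sum>j\<in>I. u j * (a j x - a j z * a i x))"
      using insert.IH[of "\<lambda>j x. a j x - a j z * a i x" "\<lambda>x. c x - c z * a i x"]
        lin_proj insert.prems by auto
    \<comment> \<open>This is the coefficient that \<open>a i\<close> must get once the projected
      identity is expanded; it is nonnegative because \<open>c z\<close> is positive and each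
      \<open>a j z\<close> is nonpositive.\<close>
    define w where "w = c z - (\<Sum>j\<in>I. u j * a j z)"
    have "(\<Sum>j\<in>I. u j * a j z) \<le> 0"
      using u(1) zj by (intro sum_nonpos) (auto simp: mult_nonneg_nonpos)
    then have "0 \<le> w" using zc by (simp add: w_def)
    moreover have "c x = w * a i x + (\<Sum>j\<in>I. u j * a j x)" for x
      using u(2)[rule_format, of x]
      by (simp add: w_def algebra_simps sum_subtractf sum_distrib_left)
    moreover have "(\<Sum>j\<in>I. (u(i := w)) j * a j x) = (\<Sum>j\<in>I. u j * a j x)" for x
      using insert.hyps by (intro sum.cong) auto
    ultimately show ?thesis
      using u(1) insert.hyps by (intro exI[of _ "u(i := w)"]) auto
  qed
qed

text \<open>Natural multipliers turn a Farkas certificate into a multiset of inequalities;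
  \<open>n\<close> later becomes the number of copies in rule \<open>C\<close>.\<close>

lemma clear_denominators:
  fixes u :: "'i \<Rightarrow> rat"
  assumes "finite I" and "\<And>i. i \<in> I \<Longrightarrow> 0 \<le> u i"
  shows "\<exists>n>0. \<exists>k::'i \<Rightarrow> nat. \<forall>i\<in>I. of_nat n * u i = of_nat (k i)"
  using assms
proof (induction I rule: finite_induct)
  case empty
  then show ?case by auto
next
  case (insert i I)
  then obtain n k where nk: "n > 0" "\<forall>j\<in>I. of_nat n * u j = of_nat (k j)"
    by auto
  obtain p q :: nat where pq: "q > 0" "u i = of_nat p / of_nat q"
  proof -
    obtain a b where ab: "quotient_of (u i) = (a, b)" by force
    then have "b > 0" "u i = of_int a / of_int b"
      by (simp_all add: quotient_of_denom_pos quotient_of_div)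
    moreover from this insert.prems[of i] have "a \<ge> 0"
      by (simp add: zero_le_divide_iff)
    ultimately show ?thesis
      by (intro that[of "nat b" "nat a"]) auto
  qed
  have "of_nat (n * q) * u j = of_nat (((\<lambda>j. q * k j)(i := n * p)) j)" if "j \<in> insert i I" for j
    using that nk pq insert.hyps by (auto simp: field_simps)
  then show ?case using nk(1) pq(1)
    by (intro exI[of _ "n * q"] conjI exI[of _ "(\<lambda>j. q * k j)(i := n * p)"]) auto
qed

subsection \<open>Soundness\<close>

lemma sum_image_repeat_mset:
  "(\<Sum>A\<in>#repeat_mset n M. f A) = of_nat n * (\<Sum>A\<in>#M. f A :: 'c::comm_semiring_1)"
  by (induction n) (simp_all add: algebra_simps)

lemma GLs_sound:
  assumes "GLs S"
  shows "luk_valid S"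
proof -
  have "(\<Sum>A\<in>#fst S. v A) \<le> (\<Sum>B\<in>#snd S. v B)" if v: "valuation v" for v
    using assms
  proof (induction rule: GLs.induct)
    case (ax_bot A)
    then show ?case using v by (auto simp: valuation_def)
  next
    case (W \<Gamma> \<Delta> A)
    have "v A \<le> 0" using v by (auto simp: valuation_def)
    then show ?case using W by simp
  next
    case (C n \<Gamma> \<Delta>)
    then show ?case by (simp add: sum_image_repeat_mset)
  next
    case (Imp_l \<Gamma> B A \<Delta>)
    \<comment> \<open>Since \<open>min 0 (b - a) = b - a + min 0 (a - b)\<close>, premise and
      conclusion state the same inequality.\<close>
    then show ?case using v by (simp add: valuation_def min_def split: if_splits)
  next
    case (Imp_r \<Gamma> \<Delta> A B)
    then show ?case using v by (simp add: valuation_def min_def split: if_splits)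
  qed auto
  then show ?thesis by (simp add: luk_valid_def)
qed

subsection \<open>Derived rules\<close>

lemma GLs_refl: "GLs (\<Gamma>, \<Gamma>)"
proof (induction \<Gamma>)
  case (add A \<Gamma>)
  from GLs.M[OF this GLs.ax_id[of A]] show ?case by simp
qed (rule GLs.ax_empty)

lemma GLs_weaken: "GLs (\<Gamma>, \<Delta>) \<Longrightarrow> GLs (\<Gamma> + \<Gamma>', \<Delta>)"
proof (induction \<Gamma>')
  case (add A \<Gamma>')
  from GLs.W[OF add.IH[OF add.prems], of A] show ?case by simp
qed simp

lemma GLs_bots: "GLs (replicate_mset (size \<Delta>) \<^bold>\<bottom>, \<Delta>)"
proof (induction \<Delta>)
  case (add A \<Delta>)
  from GLs.M[OF this GLs.ax_bot[of A]] show ?case by simp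
qed (simp add: GLs.ax_empty)

text \<open>This is the relaxed bound on an implication in rule form: weakening away
  \<open>B \<Rightarrow> A\<close> loses exactly the information that the relaxation
  forgets.\<close>

lemma GLs_Imp_l_weak:
  assumes "GLs (add_mset B \<Gamma>, add_mset A \<Delta>)"
  shows "GLs (add_mset (A \<^bold>\<Rightarrow> B) \<Gamma>, \<Delta>)"
  using GLs.Imp_l[of \<Gamma> B A \<Delta>] GLs.W[OF assms, of "B \<^bold>\<Rightarrow> A"] by (simp add: add_mset_commute)

text \<open>Read from conclusion to premise, \<open>\<Phi>\<close> on the left permits adding
  \<open>\<Theta>\<close> to both sides.\<close>

definition cancels :: "'a form multiset \<Rightarrow> 'a form multiset \<Rightarrow> bool" where
  "cancels \<Phi> \<Theta> \<longleftrightarrow> (\<forall>\<Gamma> \<Delta>. GLs (\<Gamma> + \<Phi> + \<Theta>, \<Delta> + \<Theta>) \<longrightarrow> GLs (\<Gamma> + \<Phi>, \<Delta>))"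

lemma cancelsD: "cancels \<Phi> \<Theta> \<Longrightarrow> GLs (\<Gamma> + \<Phi> + \<Theta>, \<Delta> + \<Theta>) \<Longrightarrow> GLs (\<Gamma> + \<Phi>, \<Delta>)"
  by (simp add: cancels_def)

lemma cancels_empty: "cancels \<Phi> {#}"
  by (simp add: cancels_def)

text \<open>\<open>\<Theta>2\<close> is removed first, while \<open>\<Theta>1\<close> is still on
  the left and may justify its removal. This lets the detour descend through nested
  subformulas.\<close>

lemma cancels_add:
  assumes "cancels \<Phi> \<Theta>1" "cancels (\<Phi> + \<Theta>1) \<Theta>2"
  shows "cancels \<Phi> (\<Theta>1 + \<Theta>2)"
  unfolding cancels_def
proof (intro allI impI)
  fix \<Gamma> \<Delta>
  assume "GLs (\<Gamma> + \<Phi> + (\<Theta>1 + \<Theta>2), \<Delta> + (\<Theta>1 + \<Theta>2))"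
  then have "GLs (\<Gamma> + (\<Phi> + \<Theta>1) + \<Theta>2, (\<Delta> + \<Theta>1) + \<Theta>2)" by (simp add: ac_simps)
  then have "GLs (\<Gamma> + (\<Phi> + \<Theta>1), \<Delta> + \<Theta>1)" by (rule cancelsD[OF assms(2)])
  then have "GLs (\<Gamma> + \<Phi> + \<Theta>1, \<Delta> + \<Theta>1)" by (simp add: ac_simps)
  then show "GLs (\<Gamma> + \<Phi>, \<Delta>)" by (rule cancelsD[OF assms(1)])
qed

lemma cancels_mono_left:
  assumes "cancels \<Phi> \<Theta>"
  shows "cancels (\<Phi> + \<Psi>) \<Theta>"
  unfolding cancels_def
proof (intro allI impI)
  fix \<Gamma> \<Delta>
  assume "GLs (\<Gamma> + (\<Phi> + \<Psi>) + \<Theta>, \<Delta> + \<Theta>)"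
  then have "GLs ((\<Gamma> + \<Psi>) + \<Phi> + \<Theta>, \<Delta> + \<Theta>)" by (simp add: ac_simps)
  then have "GLs ((\<Gamma> + \<Psi>) + \<Phi>, \<Delta>)" by (rule cancelsD[OF assms])
  then show "GLs (\<Gamma> + (\<Phi> + \<Psi>), \<Delta>)" by (simp add: ac_simps)
qed

lemma cancels_repeat: "cancels \<Phi> \<Theta> \<Longrightarrow> cancels \<Phi> (repeat_mset n \<Theta>)"
  by (induction n) (simp_all add: cancels_empty cancels_add cancels_mono_left)

text \<open>Rule \<open>M\<close> with reflexivity supplies the missing rest of
  \<open>\<Theta>\<close> on both sides.\<close>

lemma cancels_subset:
  assumes "cancels \<Phi> \<Theta>" "\<Theta>' \<subseteq># \<Theta>"
  shows "cancels \<Phi> \<Theta>'"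
  unfolding cancels_def
proof (intro allI impI)
  fix \<Gamma> \<Delta>
  obtain \<Xi> where \<Xi>: "\<Theta> = \<Theta>' + \<Xi>" using assms(2) by (auto simp: subset_mset.le_iff_add)
  assume "GLs (\<Gamma> + \<Phi> + \<Theta>', \<Delta> + \<Theta>')"
  from GLs.M[OF this GLs_refl[of \<Xi>]] have "GLs (\<Gamma> + \<Phi> + \<Theta>, \<Delta> + \<Theta>)"
    by (simp add: \<Xi> ac_simps)
  then show "GLs (\<Gamma> + \<Phi>, \<Delta>)" by (rule cancelsD[OF assms(1)])
qed

text \<open>Applying \<open>(\<Rightarrow>,l)\<close> twice turns \<open>A \<Rightarrow> B\<close> into itself while adding \<open>A\<close> and \<open>B\<close> to both sides.\<close>

lemma cancels_Imp: "cancels {#A \<^bold>\<Rightarrow> B#} {#A, B#}"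
  unfolding cancels_def
proof (intro allI impI)
  fix \<Gamma> \<Delta>
  assume "GLs (\<Gamma> + {#A \<^bold>\<Rightarrow> B#} + {#A, B#}, \<Delta> + {#A, B#})"
  then have "GLs ((\<Gamma> + {#B#}) + {#A, A \<^bold>\<Rightarrow> B#}, (\<Delta> + {#A#}) + {#B#})"
    by (simp add: add_mset_commute)
  from GLs.Imp_l[OF this] have "GLs (\<Gamma> + {#B, B \<^bold>\<Rightarrow> A#}, \<Delta> + {#A#})"
    by (simp add: add_mset_commute)
  from GLs.Imp_l[OF this] show "GLs (\<Gamma> + {#A \<^bold>\<Rightarrow> B#}, \<Delta>)" .
qed

section \<open>Adding proper subformulas to both sides\<close>

fun proper_subs :: "'a form \<Rightarrow> 'a form multiset" where
  "proper_subs (A \<^bold>\<Rightarrow> B) = {#A, B#} + proper_subs A + proper_subs B"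
| "proper_subs _ = {#}"

lemma cancels_proper_subs: "cancels {#F#} (proper_subs F)"
proof (induction F)
  case (Imp A B)
  have "cancels ({#A \<^bold>\<Rightarrow> B#} + {#A, B#}) (proper_subs A)"
    using cancels_mono_left[OF Imp.IH(1), of "{#A \<^bold>\<Rightarrow> B, B#}"] by (simp add: add_mset_commute)
  moreover have "cancels ({#A \<^bold>\<Rightarrow> B#} + ({#A, B#} + proper_subs A)) (proper_subs B)"
    using cancels_mono_left[OF Imp.IH(2), of "{#A \<^bold>\<Rightarrow> B, A#} + proper_subs A"]
    by (simp add: add_mset_commute)
  ultimately show ?case
    using cancels_add cancels_Imp by (metis proper_subs.simps(1))
qed (simp_all add: cancels_empty)

lemma cancels_all_proper_subs: "cancels \<Gamma> (\<Sum>F\<in>#\<Gamma>. proper_subs F)"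
proof (induction \<Gamma>)
  case (add F \<Gamma>)
  have "cancels (add_mset F \<Gamma>) (proper_subs F)"
    using cancels_mono_left[OF cancels_proper_subs[of F], of \<Gamma>] by simp
  moreover have "cancels (add_mset F \<Gamma> + proper_subs F) (\<Sum>F\<in>#\<Gamma>. proper_subs F)"
    using cancels_mono_left[OF add, of "add_mset F (proper_subs F)"] by simp
  ultimately show ?case by (simp add: cancels_add)
qed (simp add: cancels_empty)

abbreviation imp_of :: "'a form \<times> 'a form \<Rightarrow> 'a form" where
  "imp_of p \<equiv> fst p \<^bold>\<Rightarrow> snd p"

text \<open>Each right implication is either dropped or split, according to the two premises of
  \<open>Imp_r\<close>; \<open>Q\<close> collects the pairs that are split on a given
  branch.\<close>

lemma GLs_Imp_r_multi:
  assumes "\<And>Q. Q \<subseteq># P \<Longrightarrow> GLs (\<Gamma> + image_mset fst Q, \<Delta> + image_mset snd Q)"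
  shows "GLs (\<Gamma>, \<Delta> + image_mset imp_of P)"
  using assms
proof (induction P arbitrary: \<Gamma> \<Delta>)
  case empty
  from empty[of "{#}"] show ?case by simp
next
  case (add p P)
  have "GLs (\<Gamma>, \<Delta> + image_mset imp_of P)"
  proof (rule add.IH)
    fix Q assume "Q \<subseteq># P"
    then have "Q \<subseteq># add_mset p P"
      by (metis add_mset_add_single mset_subset_eq_add_left subset_mset.order_trans)
    then show "GLs (\<Gamma> + image_mset fst Q, \<Delta> + image_mset snd Q)" by (rule add.prems)
  qed
  moreover have "GLs (\<Gamma> + {#fst p#}, (\<Delta> + {#snd p#}) + image_mset imp_of P)"
  proof (rule add.IH)
    fix Q assume "Q \<subseteq># P"
    then have "add_mset p Q \<subseteq># add_mset p P" by simp
    from add.prems[OF this] show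
      "GLs (\<Gamma> + {#fst p#} + image_mset fst Q, \<Delta> + {#snd p#} + image_mset snd Q)" by simp
  qed
  ultimately show ?case
    using GLs.Imp_r[of \<Gamma> "\<Delta> + image_mset imp_of P" "fst p" "snd p"] by (simp add: add_mset_commute)
qed


subsection \<open>The linear relaxation\<close>

text \<open>A sequent becomes a linear functional, nonpositive where the sequent holds. Rational
  values keep the Farkas multipliers rational, so that their denominators can be cleared.\<close>

definition gap :: "'a sequent \<Rightarrow> ('a form \<Rightarrow> rat) \<Rightarrow> rat" where
  "gap S x = (\<Sum>A\<in>#fst S. x A) - (\<Sum>B\<in>#snd S. x B)"

lemma lin_gap: "lin (gap S)"
proof -
  have "(\<Sum>A\<in>#M. x A + r * y A) = (\<Sum>A\<in>#M. x A) + r * (\<Sum>A\<in>#M. y A)"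
    for M :: "'a form multiset" and x y and r :: rat
    by (induction M) (simp_all add: algebra_simps)
  then show ?thesis by (simp add: lin_def gap_def algebra_simps)
qed

text \<open>In the relaxation, formulas are independent variables subject only to \<open>\<bottom> \<le> A \<le> 0\<close> and
  \<open>A \<Rightarrow> B \<le> B - A\<close>.\<close>

definition relax :: "'a form set \<Rightarrow> 'a sequent set" where
  "relax V = (\<lambda>A. ({#A#}, {#})) ` V \<union> (\<lambda>A. ({#\<^bold>\<bottom>#}, {#A#})) ` V
     \<union> (\<lambda>p. ({#imp_of p, fst p#}, {#snd p#})) ` {p. imp_of p \<in> V}"

definition relaxed :: "'a form set \<Rightarrow> ('a form \<Rightarrow> rat) \<Rightarrow> bool" where
  "relaxed V x \<longleftrightarrow> (\<forall>A\<in>V. x A \<le> 0 \<and> x \<^bold>\<bottom> \<le> x A) \<and>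
     (\<forall>A B. (A \<^bold>\<Rightarrow> B) \<in> V \<longrightarrow> x (A \<^bold>\<Rightarrow> B) + x A \<le> x B)"

lemma finite_relax:
  assumes "finite V"
  shows "finite (relax V)"
proof -
  have "inj imp_of" by (auto simp: inj_def)
  then have "finite {p. imp_of p \<in> V}" using finite_vimageI[OF assms] by (simp add: vimage_def)
  then show ?thesis using assms by (simp add: relax_def)
qed

lemma relaxed_iff_gap: "relaxed V x \<longleftrightarrow> (\<forall>s\<in>relax V. gap s x \<le> 0)"
  by (auto simp: relaxed_def relax_def gap_def ball_Un)

text \<open>Indicator functions read off the multiplicities, so an identity of linear functionals
  becomes an equation between multisets.\<close>

lemma multiset_eq_if_sums_eq:
  assumes "\<And>x::'b \<Rightarrow> rat. (\<Sum>A\<in>#M. x A) = (\<Sum>A\<in>#N. x A)"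
  shows "M = N"
proof (rule multiset_eqI)
  fix B
  have "(\<Sum>A\<in>#L. if A = B then 1 else 0) = (of_nat (count L B) :: rat)" for L :: "'b multiset"
    by (induction L) auto
  then show "count M B = count N B"
    using assms[of "\<lambda>A. if A = B then 1 else 0"] by simp
qed

lemma sum_as_sum_mset:
  assumes "finite I"
  shows "\<exists>K. set_mset K \<subseteq> I \<and> (\<forall>g. (\<Sum>s\<in>#K. g s) = (\<Sum>s\<in>I. of_nat (k s) * g s :: rat))"
  using assms
proof (induction I rule: finite_induct)
  case (insert i I)
  then obtain K where "set_mset K \<subseteq> I" "\<forall>g. (\<Sum>s\<in>#K. g s) = (\<Sum>s\<in>I. of_nat (k s) * g s :: rat)"
    by blast
  then show ?case using insert.hyps
    by (intro exI[of _ "replicate_mset (k i) i + K"]) (auto split: if_splits)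
qed auto

text \<open>The certificate is sorted by kind of inequality: \<open>a\<close> collects the uses of
  \<open>A \<le> 0\<close>, \<open>b\<close> those of \<open>\<bottom> \<le> A\<close>, and
  \<open>c\<close> those of the bound on implications.\<close>

lemma sum_gap_relax:
  assumes "set_mset K \<subseteq> relax V"
  shows "\<exists>a b c. \<forall>x. (\<Sum>s\<in>#K. gap s x) =
    (\<Sum>A\<in>#a + replicate_mset (size b) \<^bold>\<bottom> + image_mset imp_of c + image_mset fst c. x A)
      - (\<Sum>A\<in>#b + image_mset snd c. x A)"
  using assms
proof (induction K)
  case empty
  show ?case by (intro exI[of _ "{#}"]) simp
next
  case (add s K)
  then obtain a b c where abc: "\<forall>x. (\<Sum>s\<in>#K. gap s x) =
    (\<Sum>A\<in>#a + replicate_mset (size b) \<^bold>\<bottom> + image_mset imp_of c + image_mset fst c. x A)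
      - (\<Sum>A\<in>#b + image_mset snd c. x A)" by auto
  from add.prems consider A where "s = ({#A#}, {#})" | A where "s = ({#\<^bold>\<bottom>#}, {#A#})"
    | p where "s = ({#imp_of p, fst p#}, {#snd p#})"
    by (auto simp: relax_def)
  then show ?case
  proof cases
    case (1 A)
    show ?thesis using abc by (intro exI[of _ "add_mset A a"] exI[of _ b] exI[of _ c]) (simp add: 1 gap_def)
  next
    case (2 A)
    show ?thesis using abc by (intro exI[of _ a] exI[of _ "add_mset A b"] exI[of _ c]) (simp add: 2 gap_def)
  next
    case (3 p)
    show ?thesis using abc by (intro exI[of _ a] exI[of _ b] exI[of _ "add_mset p c"]) (simp add: 3 gap_def)
  qed
qed

text \<open>A formula in both \<open>a\<close> and \<open>b\<close> is eliminated:
  \<open>\<bottom> \<le> A\<close> and \<open>A \<le> 0\<close> add up to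
  \<open>\<bottom> \<le> 0\<close>. Once nothing can be eliminated and no \<open>\<bottom>\<close>
  is left in \<open>b\<close>, all of \<open>b\<close> lies in \<open>\<Delta>\<close>, and the
  axioms with weakening suffice.\<close>

lemma GLs_of_bot_certificate:
  assumes "\<Gamma> + b = \<Delta> + a + replicate_mset (size b) \<^bold>\<bottom>"
  shows "GLs (\<Gamma>, \<Delta>)"
  using assms
proof (induction "size b" arbitrary: a b rule: less_induct)
  case less
  consider A where "A \<in># a" "A \<in># b" | "\<^bold>\<bottom> \<in># b" | "set_mset a \<inter> set_mset b = {}" "\<^bold>\<bottom> \<notin># b"
    by blast
  then show ?case
  proof cases
    case (1 A)
    then obtain a' b' where "a = add_mset A a'" "b = add_mset A b'" by (meson multi_member_split)
    then show ?thesis using less.hyps[of b' "add_mset \<^bold>\<bottom> a'"] less.prems by simp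
  next
    case 2
    then obtain b' where "b = add_mset \<^bold>\<bottom> b'" by (meson multi_member_split)
    then show ?thesis using less.hyps[of b' a] less.prems by simp
  next
    case 3
    have "b \<subseteq># \<Delta>"
    proof (rule mset_subset_eqI)
      fix A
      show "count b A \<le> count \<Delta> A"
      proof (cases "A \<in># b")
        case True
        then have "count a A = 0" "A \<noteq> \<^bold>\<bottom>" using 3 by (auto simp: count_eq_zero_iff)
        then show ?thesis using arg_cong[OF less.prems, of "\<lambda>M. count M A"] by simp
      qed (simp add: not_in_iff)
    qed
    then obtain \<Delta>' where \<Delta>': "\<Delta> = b + \<Delta>'" by (auto simp: subset_mset.le_iff_add)
    then have "\<Gamma> = replicate_mset (size b) \<^bold>\<bottom> + \<Delta>' + a" using less.prems by (simp add: ac_simps)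
    then show ?thesis
      using GLs_weaken[OF GLs.M[OF GLs_bots[of b] GLs_refl[of \<Delta>']], of a] \<Delta>' by simp
  qed
qed

text \<open>A largest implication \<open>A \<Rightarrow> B\<close> used in the certificate cannot occur as a \<open>B\<close>-term of it; so it
  sits in \<open>\<Gamma>\<close>, where the left rule replaces it, or in \<open>b\<close>, where the two inequalities on it combine.\<close>

lemma GLs_of_certificate:
  assumes "\<Gamma> + (b + image_mset snd c) =
    \<Delta> + (a + replicate_mset (size b) \<^bold>\<bottom> + image_mset imp_of c + image_mset fst c)"
  shows "GLs (\<Gamma>, \<Delta>)"
  using assms
proof (induction "size c" arbitrary: \<Gamma> \<Delta> a b c)
  case 0
  then show ?case using GLs_of_bot_certificate[of \<Gamma> b \<Delta> a] by (simp add: ac_simps)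
next
  case (Suc n)
  let ?m = "\<lambda>p. size (imp_of p)"
  have "set_mset c \<noteq> {}" using Suc.hyps(2) by auto
  then obtain p where p: "p \<in># c" and max: "\<And>q. q \<in># c \<Longrightarrow> ?m q \<le> ?m p"
    using Max_in[of "?m ` set_mset c"] Max_ge[of "?m ` set_mset c"] by fastforce
  obtain c' where c': "c = add_mset p c'" using p by (meson multi_member_split)
  have n: "n = size c'" using Suc.hyps(2) c' by simp
  have "imp_of p \<notin># image_mset snd c"
  proof
    assume "imp_of p \<in># image_mset snd c"
    then obtain q where "q \<in># c" "imp_of p = snd q" by auto
    then show False using max[of q] by simp
  qed
  moreover have "imp_of p \<in># \<Gamma> + (b + image_mset snd c)"
    unfolding Suc.prems using c' by simp
  ultimately consider "imp_of p \<in># \<Gamma>" | "imp_of p \<in># b" by auto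
  then show ?case
  proof cases
    case 1
    then obtain \<Gamma>' where \<Gamma>': "\<Gamma> = add_mset (imp_of p) \<Gamma>'" by (meson multi_member_split)
    have "GLs (add_mset (snd p) \<Gamma>', add_mset (fst p) \<Delta>)"
      by (rule Suc.hyps(1)[OF n, of _ b _ a]) (use Suc.prems c' \<Gamma>' in simp)
    then show ?thesis unfolding \<Gamma>' by (rule GLs_Imp_l_weak)
  next
    case 2
    then obtain b' where b': "b = add_mset (imp_of p) b'" by (meson multi_member_split)
    \<comment> \<open>With \<open>p = (A, B)\<close>, the bounds
      \<open>\<bottom> \<le> A \<Rightarrow> B\<close> and
      \<open>(A \<Rightarrow> B) + A \<le> B\<close> have the same sum as
      \<open>\<bottom> \<le> B\<close> and \<open>A \<le> 0\<close>.\<close>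
    show ?thesis
      by (rule Suc.hyps(1)[OF n, of _ "add_mset (snd p) b'" _ "add_mset (fst p) a"])
        (use Suc.prems c' b' in simp)
  qed
qed

lemma GLs_of_relaxed:
  assumes "finite V" and "\<And>x. relaxed V x \<Longrightarrow> gap (\<Gamma>, \<Delta>) x \<le> 0"
  shows "GLs (\<Gamma>, \<Delta>)"
proof -
  obtain u where u: "\<forall>s\<in>relax V. 0 \<le> u s"
    "\<forall>x. gap (\<Gamma>, \<Delta>) x = (\<Sum>s\<in>relax V. u s * gap s x)"
    using farkas[of "relax V" gap "gap (\<Gamma>, \<Delta>)"] assms
    by (auto simp: finite_relax lin_gap relaxed_iff_gap)
  obtain n k where n: "n > 0" and k: "\<forall>s\<in>relax V. of_nat n * u s = of_nat (k s)"
    using clear_denominators[of "relax V" u] u(1) assms(1) finite_relax by blast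
  obtain K where K: "set_mset K \<subseteq> relax V"
    "\<forall>g. (\<Sum>s\<in>#K. g s) = (\<Sum>s\<in>relax V. of_nat (k s) * g s :: rat)"
    using sum_as_sum_mset[OF finite_relax[OF assms(1)], of k] by blast
  obtain a b c where abc: "\<forall>x. (\<Sum>s\<in>#K. gap s x) =
    (\<Sum>A\<in>#a + replicate_mset (size b) \<^bold>\<bottom> + image_mset imp_of c + image_mset fst c. x A)
      - (\<Sum>A\<in>#b + image_mset snd c. x A)"
    using sum_gap_relax[OF K(1)] by blast
  have gap_n: "of_nat n * gap (\<Gamma>, \<Delta>) x = (\<Sum>s\<in>#K. gap s x)" for x
  proof -
    have "of_nat n * gap (\<Gamma>, \<Delta>) x = (\<Sum>s\<in>relax V. (of_nat n * u s) * gap s x)"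
      by (simp add: u(2) sum_distrib_left mult.assoc)
    also have "\<dots> = (\<Sum>s\<in>#K. gap s x)" using k K(2) by simp
    finally show ?thesis .
  qed
  have "repeat_mset n \<Gamma> + (b + image_mset snd c) = repeat_mset n \<Delta> +
      (a + replicate_mset (size b) \<^bold>\<bottom> + image_mset imp_of c + image_mset fst c)"
  proof (rule multiset_eq_if_sums_eq)
    fix x :: "'a form \<Rightarrow> rat"
    show "(\<Sum>A\<in>#repeat_mset n \<Gamma> + (b + image_mset snd c). x A) = (\<Sum>A\<in>#repeat_mset n \<Delta> +
      (a + replicate_mset (size b) \<^bold>\<bottom> + image_mset imp_of c + image_mset fst c). x A)"
      using gap_n[of x] abc[rule_format, of x]
      by (simp add: gap_def sum_image_repeat_mset algebra_simps)
  qed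
  then have "GLs (repeat_mset n \<Gamma>, repeat_mset n \<Delta>)" by (rule GLs_of_certificate)
  then show ?thesis by (rule GLs.C[OF n])
qed

text \<open>Farkas' lemma for both families at once gives a multiplier for each \<open>s j\<close>;
  their sum bounds each of them and serves as one penalty factor \<open>N\<close> for all
  points.\<close>

lemma exact_penalty:
  fixes a :: "'i \<Rightarrow> ('b \<Rightarrow> 'f::linordered_field) \<Rightarrow> 'f" and s :: "'j \<Rightarrow> ('b \<Rightarrow> 'f) \<Rightarrow> 'f"
  assumes "finite I" "finite J" and "\<And>i. i \<in> I \<Longrightarrow> lin (a i)" "\<And>j. j \<in> J \<Longrightarrow> lin (s j)" "lin c"
    and impl: "\<And>x. (\<And>i. i \<in> I \<Longrightarrow> a i x \<le> 0) \<Longrightarrow> (\<And>j. j \<in> J \<Longrightarrow> s j x \<le> 0) \<Longrightarrow> c x \<le> 0"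
  shows "\<exists>N. \<forall>x. (\<forall>i\<in>I. a i x \<le> 0) \<longrightarrow> (\<forall>j\<in>J. 0 \<le> s j x) \<longrightarrow> c x \<le> N * (\<Sum>j\<in>J. s j x)"
proof -
  have "\<exists>u. (\<forall>i\<in>I <+> J. 0 \<le> u i) \<and> (\<forall>x. c x = (\<Sum>i\<in>I <+> J. u i * case_sum a s i x))"
  proof (rule farkas)
    fix x assume "\<And>i. i \<in> I <+> J \<Longrightarrow> case_sum a s i x \<le> 0"
    from this[OF InlI] this[OF InrI] show "c x \<le> 0" by (intro impl) auto
  qed (use assms in auto)
  then obtain u where u0: "\<forall>i\<in>I <+> J. 0 \<le> u i"
    and u: "\<forall>x. c x = (\<Sum>i\<in>I <+> J. u i * case_sum a s i x)" by blast
  let ?N = "\<Sum>j\<in>J. u (Inr j)"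
  have "c x \<le> ?N * (\<Sum>j\<in>J. s j x)" if "\<forall>i\<in>I. a i x \<le> 0" "\<forall>j\<in>J. 0 \<le> s j x" for x
  proof -
    have "c x = (\<Sum>i\<in>I. u (Inl i) * a i x) + (\<Sum>j\<in>J. u (Inr j) * s j x)"
      using u assms(1,2) by (simp add: sum.Plus)
    moreover have "(\<Sum>i\<in>I. u (Inl i) * a i x) \<le> 0"
      using that u0 by (intro sum_nonpos mult_nonneg_nonpos) auto
    moreover have "(\<Sum>j\<in>J. u (Inr j) * s j x) \<le> (\<Sum>j\<in>J. ?N * s j x)"
      using that u0 assms(2) by (intro sum_mono mult_right_mono member_le_sum) auto
    ultimately show ?thesis by (simp add: sum_distrib_left)
  qed
  then show ?thesis by blast
qed

subsection \<open>Completeness\<close>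

primrec eval :: "('a \<Rightarrow> real) \<Rightarrow> 'a form \<Rightarrow> real" where
  "eval w (Var p) = w p"
| "eval w \<^bold>\<bottom> = -1"
| "eval w (A \<^bold>\<Rightarrow> B) = min 0 (eval w B - eval w A)"

lemma valuation_eval:
  assumes "\<And>p. w p \<in> {-1..0}"
  shows "valuation (eval w)"
proof -
  have "eval w A \<in> {-1..0}" for A
    using assms by (induction A) (auto simp: min_def)
  then show ?thesis by (simp add: valuation_def)
qed

section \<open>From points of the relaxation to valuations\<close>

lemma proper_subs_closed:
  assumes "(A \<^bold>\<Rightarrow> B) \<in># proper_subs F"
  shows "A \<in># proper_subs F \<and> B \<in># proper_subs F"
  using assms by (induction F) auto

lemma all_proper_subs_closed:
  assumes "(A \<^bold>\<Rightarrow> B) \<in># (\<Sum>F\<in>#\<Gamma>. proper_subs F)"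
  shows "A \<in># (\<Sum>F\<in>#\<Gamma>. proper_subs F)" "B \<in># (\<Sum>F\<in>#\<Gamma>. proper_subs F)"
  using assms proper_subs_closed by (fastforce simp: in_Union_mset_iff)+

text \<open>A point of the relaxation at which every implication in \<open>P\<close> takes one of its two exact values
  is, up to scaling, a valuation on \<open>P\<close>.\<close>

lemma gap_nonpos_if_exact:
  fixes \<Gamma> \<Delta> :: "'a form multiset"
  defines "P \<equiv> set_mset (\<Sum>F\<in>#\<Gamma>. proper_subs F)"
  assumes valid: "luk_valid (\<Gamma>, \<Delta>)"
    and atomic: "\<And>A B. (A \<^bold>\<Rightarrow> B) \<notin># \<Delta>"
    and V: "set_mset \<Gamma> \<subseteq> V" "set_mset \<Delta> \<subseteq> V" "P \<subseteq> V" "\<^bold>\<bottom> \<in> V"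
    and relaxed: "relaxed V x"
    and exact: "\<And>A B. (A \<^bold>\<Rightarrow> B) \<in> P \<Longrightarrow> 0 \<le> x (A \<^bold>\<Rightarrow> B) \<or> x B \<le> x (A \<^bold>\<Rightarrow> B) + x A"
  shows "gap (\<Gamma>, \<Delta>) x \<le> 0"
proof (cases "x \<^bold>\<bottom> = 0")
  case True
  \<comment> \<open>Here \<open>x\<close> cannot be scaled to give \<open>\<bottom>\<close> the
    value -1, but all of \<open>V\<close> is squeezed between 0 and 0.\<close>
  have "x A = 0" if "A \<in> V" for A
    using relaxed that True by (force simp: relaxed_def)
  then have "(\<Sum>A\<in>#M. x A) = 0" if "set_mset M \<subseteq> V" for M
    using that by (induction M) auto
  then show ?thesis using V by (simp add: gap_def)
next
  case False
  define r where "r = - x \<^bold>\<bottom>"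
  have r: "r > 0" using False relaxed V(4) by (force simp: r_def relaxed_def)
  define y where "y A = real_of_rat (x A / r)" for A
  have y_add: "y A + y B = real_of_rat ((x A + x B) / r)" for A B
    by (simp add: y_def add_divide_distrib of_rat_add)
  have y_bot: "y \<^bold>\<bottom> = -1" using r by (simp add: y_def r_def of_rat_divide of_rat_minus)
  have y_nonpos: "y A \<le> 0" if "A \<in> V" for A
    using relaxed that r by (simp add: y_def relaxed_def divide_le_0_iff)
  have y_ge: "-1 \<le> y A" if "A \<in> V" for A
  proof -
    have "y \<^bold>\<bottom> \<le> y A"
      using relaxed that r unfolding y_def of_rat_less_eq by (simp add: relaxed_def divide_right_mono)
    then show ?thesis by (simp add: y_bot)
  qed
  have y_Imp: "y (A \<^bold>\<Rightarrow> B) + y A \<le> y B" if "(A \<^bold>\<Rightarrow> B) \<in> V" for A B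
    using relaxed that r unfolding y_add unfolding y_def of_rat_less_eq
    by (simp add: relaxed_def divide_right_mono)
  have y_exact: "0 \<le> y (A \<^bold>\<Rightarrow> B) \<or> y B \<le> y (A \<^bold>\<Rightarrow> B) + y A" if "(A \<^bold>\<Rightarrow> B) \<in> P" for A B
    using exact[OF that] r unfolding y_add unfolding y_def of_rat_less_eq
    by (auto simp: divide_right_mono)
  \<comment> \<open>The default 0 keeps \<open>w\<close> within the range required of a
    valuation.\<close>
  define w where "w p = (if Var p \<in> V then y (Var p) else 0)" for p
  have val: "valuation (eval w)"
    by (rule valuation_eval) (simp add: w_def y_nonpos y_ge)
  have P_eq: "eval w A = y A" if "A \<in> P" for A
    using that
  proof (induction A)
    case (Imp A B)
    then have "A \<in> P" "B \<in> P" using all_proper_subs_closed unfolding P_def by blast+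
    then show ?case
      using Imp y_exact[OF Imp.prems] y_Imp[of A B] y_nonpos[of "A \<^bold>\<Rightarrow> B"] V(3) by auto
  qed (use V in \<open>auto simp: w_def y_bot\<close>)
  \<comment> \<open>Formulas of \<open>\<Gamma>\<close> stand on the smaller side, so an upper bound
    on \<open>y F\<close> is enough; equality is needed only for their proper subformulas.\<close>
  have \<Gamma>_le: "y F \<le> eval w F" if F: "F \<in># \<Gamma>" for F
  proof (cases F)
    case (Imp A B)
    then have "A \<in># proper_subs F" "B \<in># proper_subs F" by auto
    then have "A \<in> P" "B \<in> P" using F by (auto simp: P_def in_Union_mset_iff)
    then show ?thesis using P_eq y_Imp[of A B] y_nonpos[of F] F V(1) Imp by auto
  qed (use F V y_bot in \<open>auto simp: w_def\<close>)
  have \<Delta>_eq: "eval w B = y B" if B: "B \<in># \<Delta>" for B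
    using B atomic V y_bot by (cases B) (auto simp: w_def)
  have sum_y: "(\<Sum>A\<in>#M. y A) = real_of_rat ((\<Sum>A\<in>#M. x A) / r)" for M
    by (induction M) (simp_all add: y_def add_divide_distrib of_rat_add)
  have "(\<Sum>A\<in>#\<Gamma>. y A) \<le> (\<Sum>A\<in>#\<Gamma>. eval w A)"
    by (rule sum_mset_mono) (rule \<Gamma>_le)
  also have "\<dots> \<le> (\<Sum>B\<in>#\<Delta>. eval w B)"
    using valid val by (simp add: luk_valid_def)
  also have "\<dots> = (\<Sum>B\<in>#\<Delta>. y B)"
    using \<Delta>_eq by (simp cong: image_mset_cong)
  finally have "(\<Sum>A\<in>#\<Gamma>. x A) / r \<le> (\<Sum>A\<in>#\<Delta>. x A) / r"
    by (simp add: sum_y of_rat_less_eq)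
  then show ?thesis using r by (simp add: gap_def divide_le_cancel)
qed

lemma sum_mset_eq_sum_count:
  assumes "finite E" "set_mset Q \<subseteq> E"
  shows "(\<Sum>p\<in>#Q. g p) = (\<Sum>p\<in>E. of_nat (count Q p) * g p :: rat)"
  using assms(2)
proof (induction Q)
  case (add q Q)
  have "(\<Sum>p\<in>E. of_nat (count (add_mset q Q) p) * g p) =
      (\<Sum>p\<in>E. of_nat (count Q p) * g p + (if p = q then g p else 0))"
    by (intro sum.cong) (auto simp: algebra_simps)
  also have "\<dots> = (\<Sum>p\<in>E. of_nat (count Q p) * g p) + g q"
    using add.prems assms(1) by (simp add: sum.distrib)
  finally show ?case using add by simp
qed simp

text \<open>Add \<open>2 N\<close> copies of every proper implication \<open>A \<Rightarrow> B\<close> to both sides and apply \<open>(\<Rightarrow>,r)\<close> to the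
  right copies. In each resulting sequent, either at least \<open>N\<close> of the left copies are unmatched, which
  penalizes \<open>A \<Rightarrow> B < 0\<close>, or at least \<open>N\<close> of them are matched by \<open>A \<turnstile> B\<close>, which penalizes
  \<open>A \<Rightarrow> B < B - A\<close>. For large \<open>N\<close> these penalties make the sequent valid in the relaxation.\<close>

lemma GLs_complete_atomic:
  fixes \<Gamma> \<Delta> :: "'a form multiset"
  assumes valid: "luk_valid (\<Gamma>, \<Delta>)" and atomic: "\<And>A B. (A \<^bold>\<Rightarrow> B) \<notin># \<Delta>"
  shows "GLs (\<Gamma>, \<Delta>)"
proof -
  define \<Theta> where "\<Theta> = (\<Sum>F\<in>#\<Gamma>. proper_subs F)"
  define E where "E = {p. imp_of p \<in># \<Theta>}"
  define V where "V = set_mset \<Gamma> \<union> set_mset \<Delta> \<union> set_mset \<Theta> \<union> {\<^bold>\<bottom>}"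
  have inj: "inj imp_of" by (auto simp: inj_def)
  have finE: "finite E"
    unfolding E_def using finite_vimageI[OF finite_set_mset[of \<Theta>] inj] by (simp add: vimage_def)
  have finV: "finite V" by (simp add: V_def)
  \<comment> \<open>The set \<open>\<beta>\<close> selects, for each implication in
    \<open>E\<close>, which of its two exact values is aimed at; \<open>slack\<close> measures how
    far \<open>x\<close> falls short of it.\<close>
  define slack where
    "slack \<beta> p = (if p \<in> \<beta> then gap ({#}, {#imp_of p#}) else gap ({#snd p#}, {#imp_of p, fst p#}))"
    for \<beta> :: "('a form \<times> 'a form) set" and p
  have slack_nonneg: "0 \<le> slack \<beta> p x" if "p \<in> E" "relaxed V x" for \<beta> p x
    using that by (cases p) (auto simp: slack_def E_def V_def relaxed_def gap_def)
  have "\<exists>N. \<forall>x. relaxed V x \<longrightarrow> gap (\<Gamma>, \<Delta>) x \<le> N * (\<Sum>p\<in>E. slack \<beta> p x)" for \<beta>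
  proof -
    have "\<exists>N. \<forall>x. (\<forall>s\<in>relax V. gap s x \<le> 0) \<longrightarrow> (\<forall>p\<in>E. 0 \<le> slack \<beta> p x) \<longrightarrow>
        gap (\<Gamma>, \<Delta>) x \<le> N * (\<Sum>p\<in>E. slack \<beta> p x)"
    proof (rule exact_penalty)
      fix x
      assume "\<And>s. s \<in> relax V \<Longrightarrow> gap s x \<le> 0" and slack: "\<And>p. p \<in> E \<Longrightarrow> slack \<beta> p x \<le> 0"
      then have "relaxed V x" by (simp add: relaxed_iff_gap)
      moreover have "0 \<le> x (A \<^bold>\<Rightarrow> B) \<or> x B \<le> x (A \<^bold>\<Rightarrow> B) + x A" if "(A \<^bold>\<Rightarrow> B) \<in># \<Theta>" for A B
        using slack[of "(A, B)"] that by (auto simp: E_def slack_def gap_def split: if_splits)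
      ultimately show "gap (\<Gamma>, \<Delta>) x \<le> 0"
        using valid atomic by (intro gap_nonpos_if_exact[of \<Gamma> \<Delta> V]) (auto simp: V_def \<Theta>_def)
    qed (use finE finV in \<open>auto simp: finite_relax lin_gap slack_def\<close>)
    then show ?thesis using slack_nonneg by (simp add: relaxed_iff_gap)
  qed
  then obtain N0 where N0:
    "\<And>\<beta> x. relaxed V x \<Longrightarrow> gap (\<Gamma>, \<Delta>) x \<le> N0 \<beta> * (\<Sum>p\<in>E. slack \<beta> p x)"
    by metis
  \<comment> \<open>\<open>E\<close> has finitely many subsets, so one \<open>N\<close> serves every
    choice of \<open>\<beta>\<close>.\<close>
  obtain N :: nat where "Max (N0 ` Pow E) \<le> of_nat N" using real_arch_simple by blast
  then have "N0 \<beta> \<le> of_nat N" if "\<beta> \<subseteq> E" for \<beta>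
    using that finE Max_ge[of "N0 ` Pow E" "N0 \<beta>"] by fastforce
  then have N: "gap (\<Gamma>, \<Delta>) x \<le> of_nat N * (\<Sum>p\<in>E. slack \<beta> p x)" if "\<beta> \<subseteq> E" "relaxed V x" for \<beta> x
    using that slack_nonneg by (intro order_trans[OF N0[of x \<beta>]] mult_right_mono sum_nonneg) auto
  let ?P = "repeat_mset (2 * N) (mset_set E)"
  have leaf: "GLs (\<Gamma> + image_mset imp_of ?P + image_mset fst Q, \<Delta> + image_mset snd Q)"
    if Q: "Q \<subseteq># ?P" for Q
  proof (rule GLs_of_relaxed[OF finV])
    fix x assume x: "relaxed V x"
    define \<beta> where "\<beta> = {p \<in> E. count Q p \<le> N}"
    have Q_le: "count Q p \<le> 2 * N" if "p \<in> E" for p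
      using mset_subset_eq_count[OF Q, of p] that finE by simp
    have "set_mset (repeat_mset n M) \<subseteq> set_mset M" for n and M :: "('a form \<times> 'a form) multiset"
      by (induction n) auto
    from this[of "2 * N" "mset_set E"] have PE: "set_mset ?P \<subseteq> E" using finE by simp
    have QE: "set_mset Q \<subseteq> E"
      using set_mset_mono[OF Q] PE by (rule subset_trans)
    let ?q = "\<lambda>p. of_nat (count Q p) :: rat"
    let ?N = "of_nat N :: rat"
    have "gap (\<Gamma> + image_mset imp_of ?P + image_mset fst Q, \<Delta> + image_mset snd Q) x
        = gap (\<Gamma>, \<Delta>) x + (\<Sum>p\<in>#?P. x (imp_of p)) + (\<Sum>p\<in>#Q. x (fst p)) - (\<Sum>p\<in>#Q. x (snd p))"
      by (simp add: gap_def multiset.map_comp comp_def)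
    also have "\<dots> = gap (\<Gamma>, \<Delta>) x + (\<Sum>p\<in>E. 2 * ?N * x (imp_of p) + ?q p * (x (fst p) - x (snd p)))"
      using finE sum_mset_eq_sum_count[OF finE PE] sum_mset_eq_sum_count[OF finE QE]
      by (simp add: sum.distrib sum_subtractf algebra_simps)
    also have "\<dots> \<le> (\<Sum>p\<in>E. ?N * slack \<beta> p x)
        + (\<Sum>p\<in>E. 2 * ?N * x (imp_of p) + ?q p * (x (fst p) - x (snd p)))"
      using N[OF _ x, of \<beta>] by (auto simp: \<beta>_def sum_distrib_left)
    also have "\<dots> = (\<Sum>p\<in>E. ?N * slack \<beta> p x
        + (2 * ?N * x (imp_of p) + ?q p * (x (fst p) - x (snd p))))"
      by (simp add: sum.distrib)
    also have "\<dots> \<le> 0"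
    proof (rule sum_nonpos)
      fix p assume p: "p \<in> E"
      let ?a = "x (imp_of p)" and ?m = "x (imp_of p) + x (fst p) - x (snd p)"
      have am: "?a \<le> 0" "?m \<le> 0"
        using x p by (cases p; auto simp: E_def V_def relaxed_def)+
      show "?N * slack \<beta> p x + (2 * ?N * ?a + ?q p * (x (fst p) - x (snd p))) \<le> 0"
      proof (cases "p \<in> \<beta>")
        case True
        then have "?q p \<le> ?N" by (simp add: \<beta>_def)
        \<comment> \<open>The left side is the summand to be bounded, regrouped so that nonnegative
          coefficients multiply the nonpositive \<open>?a\<close> and \<open>?m\<close>; the other
          case regroups likewise.\<close>
        then have "(?N - ?q p) * ?a + ?q p * ?m \<le> 0"
          using am by (intro add_nonpos_nonpos mult_nonneg_nonpos) auto
        then show ?thesis using True by (simp add: slack_def gap_def algebra_simps)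
      next
        case False
        then have "?N \<le> ?q p" using p by (simp add: \<beta>_def)
        moreover have "?q p \<le> 2 * ?N"
          using Q_le[OF p] by (metis of_nat_le_iff of_nat_mult of_nat_numeral)
        ultimately have "(2 * ?N - ?q p) * ?a + (?q p - ?N) * ?m \<le> 0"
          using am by (intro add_nonpos_nonpos mult_nonneg_nonpos) auto
        then show ?thesis using False by (simp add: slack_def gap_def algebra_simps)
      qed
    qed
    finally show
      "gap (\<Gamma> + image_mset imp_of ?P + image_mset fst Q, \<Delta> + image_mset snd Q) x \<le> 0" .
  qed
  have "image_mset imp_of (mset_set E) \<subseteq># \<Theta>"
  proof -
    have "image_mset imp_of (mset_set E) = mset_set (imp_of ` E)"
      using inj by (intro image_mset_mset_set) (auto simp: inj_on_def)
    also have "\<dots> \<subseteq># mset_set (set_mset \<Theta>)"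
      by (intro subset_imp_msubset_mset_set) (auto simp: E_def)
    also have "\<dots> \<subseteq># \<Theta>" by (rule mset_set_set_mset_msubset)
    finally show ?thesis .
  qed
  then have "cancels \<Gamma> (repeat_mset (2 * N) (image_mset imp_of (mset_set E)))"
    by (intro cancels_repeat cancels_subset[OF cancels_all_proper_subs[of \<Gamma>, folded \<Theta>_def]])
  moreover have "repeat_mset n (image_mset imp_of M) = image_mset imp_of (repeat_mset n M)"
    for n and M :: "('a form \<times> 'a form) multiset"
    by (induction n) simp_all
  ultimately have "cancels \<Gamma> (image_mset imp_of ?P)" by simp
  moreover have "GLs (\<Gamma> + image_mset imp_of ?P, \<Delta> + image_mset imp_of ?P)"
    by (rule GLs_Imp_r_multi) (rule leaf)
  ultimately show ?thesis using cancelsD[of \<Gamma> _ "{#}" \<Delta>] by simp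
qed

text \<open>Rule \<open>Imp_r\<close> preserves validity upwards, because a bound by
  \<open>min 0 (v B - v A)\<close> is a bound by both arguments. Right implications can thus be
  decomposed until the atomic case applies.\<close>

lemma GLs_complete: "luk_valid (\<Gamma>, \<Delta>) \<Longrightarrow> GLs (\<Gamma>, \<Delta>)"
proof (induction "\<Sum>B\<in>#\<Delta>. size B + 1" arbitrary: \<Gamma> \<Delta> rule: less_induct)
  case less
  show ?case
  proof (cases "\<exists>A B. (A \<^bold>\<Rightarrow> B) \<in># \<Delta>")
    case True
    then obtain A B \<Delta>' where \<Delta>: "\<Delta> = \<Delta>' + {#A \<^bold>\<Rightarrow> B#}"
      by (metis add_mset_add_single multi_member_split)
    have le: "(\<Sum>A\<in>#\<Gamma>. v A) \<le> (\<Sum>B\<in>#\<Delta>'. v B) + min 0 (v B - v A)" if "valuation v" for v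
    proof -
      have "v (A \<^bold>\<Rightarrow> B) = min 0 (v B - v A)" using that by (simp add: valuation_def)
      then show ?thesis using less.prems that by (force simp: \<Delta> luk_valid_def)
    qed
    have "luk_valid (\<Gamma>, \<Delta>')" "luk_valid (\<Gamma> + {#A#}, \<Delta>' + {#B#})"
      unfolding luk_valid_def using le by fastforce+
    then have "GLs (\<Gamma>, \<Delta>')" "GLs (\<Gamma> + {#A#}, \<Delta>' + {#B#})"
      by (auto intro!: less.hyps simp: \<Delta>)
    then show ?thesis unfolding \<Delta> by (rule GLs.Imp_r)
  qed (use less.prems GLs_complete_atomic in blast)
qed

theorem mainTheorem20:
  fixes S :: "'a sequent"
  shows "GLs S \<longleftrightarrow> luk_valid S"
  using GLs_sound GLs_complete by (cases S) blast

end
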